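(* For an integer $h\geq 1$ let $\Gamma_{2^h}$ denote the multiplicative circulant graph $MC(2^h)$, and let $\Gamma_{2^0}$ denote the one-vertex graph. Let $h$ be a positive integer. If $h=2n$, then $$d_{\Gamma_{2^h}}(0,j)=\begin{cases} d_{\Gamma_{2^{h-1}}}(0,j) & \text{if } j=0,1,2,\ldots,\tfrac{1}{3}(4^n-1),\\ d_{\Gamma_{2^{h-1}}}(0,j)+1 & \text{if } j=\tfrac{1}{3}(4^n-1)+1,\ldots,2^{h-1}.\end{cases}$$ If $h=2n+1$, then $$d_{\Gamma_{2^h}}(0,j)=\begin{cases} d_{\Gamma_{2^{h-1}}}(0,j) & \text{if } j=0,1,2,\ldots,\tfrac{2}{3}(4^n-1),\\ d_{\Gamma_{2^{h-1}}}(0,j)+1 & \text{if } j=\tfrac{2}{3}(4^n-1)+1,\ldots,2^{h-1}.\end{cases}$$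
   Context: For integers $m>1$, $h>0$, the multiplicative circulant graph $MC(m^h)$ is the graph with vertex set $\mathbb{Z}_{m^h}$ in which distinct vertices $x,y$ are adjacent if and only if $x-y\equiv \pm m^i \pmod{m^h}$ for some $i\in\{0,1,\ldots,h-1\}$ (i.e. the circulant graph $Cay(\mathbb{Z}_{m^h},\{m^0,m^1,\ldots,m^{h-1}\})$). $d_\Gamma(u,v)$ is the length of a shortest path between $u$ and $v$ in $\Gamma$. An integer $j$ used as a vertex of $\Gamma_{2^{k}}$ is identified with its residue modulo $2^{k}$ (so e.g. the vertex $2^{h-1}$ of $\Gamma_{2^{h-1}}$ is its vertex $0$). *)

theory Defs
  imports "Graph_Theory.Graph_Theory" "HOL-Number_Theory.Cong" "HOL-Library.Extended_Nat"
begin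

text \<open>
  The multiplicative circulant graph \<open>MC(m^h)\<close>. The vertices, elements of \<open>\<int>/m^h\<close>, are
  represented by the residues \<open>0, \<dots>, m^h - 1\<close>; an undirected edge is a pair of opposite arcs.
\<close>

definition mult_circulant :: "int \<Rightarrow> nat \<Rightarrow> int pair_pre_digraph" where
  "mult_circulant m h =
    \<lparr> pverts = {0..<m ^ h},
      parcs = {(x, y). x \<in> {0..<m ^ h} \<and> y \<in> {0..<m ^ h} \<and> x \<noteq> y \<and>
        (\<exists>i<h. [x - y = m ^ i] (mod m ^ h) \<or> [x - y = - (m ^ i)] (mod m ^ h))} \<rparr>"

text \<open>For \<open>h = 0\<close> this is the one-vertex graph.\<close>

lemma mult_circulant_0: "mult_circulant m 0 = \<lparr> pverts = {0}, parcs = {} \<rparr>"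
  by (auto simp: mult_circulant_def)

lemma pair_graph_mult_circulant: "pair_graph (mult_circulant m h)"
proof
  let ?G = "mult_circulant m h"
  show "fst e \<in> pverts ?G" "snd e \<in> pverts ?G" "fst e \<noteq> snd e" if "e \<in> parcs ?G" for e
    using that by (auto simp: mult_circulant_def)
  show "finite (pverts ?G)"
    by (simp add: mult_circulant_def)
  have "parcs ?G \<subseteq> {0..<m ^ h} \<times> {0..<m ^ h}"
    by (auto simp: mult_circulant_def)
  then show "finite (parcs ?G)"
    by (rule finite_subset) simp
  have swap: "[y - x = - a] (mod b)" if "[x - y = a] (mod b)" for x y a b :: int
    using that cong_minus_minus_iff[of "x - y" a b] by simp
  show "symmetric (with_proj ?G)"
    unfolding symmetric_def
  proof (rule symI)
    fix x y
    assume "(x, y) \<in> arcs_ends (with_proj ?G)"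
    then show "(y, x) \<in> arcs_ends (with_proj ?G)"
      using swap[of x y] by (fastforce simp: mult_circulant_def)
  qed
qed

text \<open>The length of a shortest path, \<open>\<infinity>\<close> if there is no path.\<close>

definition graph_dist :: "('a, 'b) pre_digraph \<Rightarrow> 'a \<Rightarrow> 'a \<Rightarrow> enat" where
  "graph_dist G u v = (INF p \<in> {p. pre_digraph.apath G u p v}. enat (length p))"

text \<open>\<open>\<Gamma>\<close> with \<open>2^h\<close> vertices, and its distance between integers \<open>i\<close>, \<open>j\<close>
  that are identified with their residues modulo \<open>2^h\<close>.\<close>

abbreviation Gamma2 :: "nat \<Rightarrow> int pair_pre_digraph" where
  "Gamma2 h \<equiv> mult_circulant 2 h"

definition Gamma2_dist :: "nat \<Rightarrow> int \<Rightarrow> int \<Rightarrow> enat" where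
  "Gamma2_dist h i j = graph_dist (with_proj (Gamma2 h)) (i mod 2 ^ h) (j mod 2 ^ h)"

end

theory Submission
  imports Defs
begin

text \<open>
  The distance \<open>D h j\<close> from \<open>0\<close> to \<open>j\<close> in \<open>\<Gamma>\<close> with \<open>2^h\<close> vertices satisfies the binary recursion
  \<open>D (h + 1) (2k) = D h k\<close> and \<open>D (h + 1) (2k + 1) = 1 + min (D h k) (D h (k + 1))\<close>: two steps
  \<open>\<plusminus>1\<close> cancel or merge into a single step \<open>\<plusminus>2\<close>, so at most one step \<open>\<plusminus>1\<close> is ever useful, and
  it is needed exactly for odd \<open>j\<close>. Write \<open>T h\<close> for the threshold; \<open>T (h + 1)\<close> is \<open>2 T h\<close> or
  \<open>2 T h + 1\<close>. By induction on \<open>h\<close>, the recursion transports \<open>D h j - D (h - 1) j\<close> from \<open>k\<close> and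
  \<open>k + 1\<close> to \<open>2k\<close> and \<open>2k + 1\<close>, except at \<open>j = 2 T h + 1\<close>, where \<open>k\<close> and \<open>k + 1\<close> lie on different
  sides of the threshold. That case is settled by comparing \<open>D (h - 1) (T h)\<close> with
  \<open>D (h - 1) (T h + 1)\<close>: they are equal for odd \<open>h\<close>, and the former is larger by one for even \<open>h\<close>.
\<close>

section \<open>Binary recursion for the weight on residues\<close>

fun mc2_weight :: "nat \<Rightarrow> int \<Rightarrow> nat" where
  "mc2_weight 0 j = 0"
| "mc2_weight (Suc h) j =
    (if even j then mc2_weight h (j div 2)
     else Suc (min (mc2_weight h (j div 2)) (mc2_weight h (j div 2 + 1))))"

lemma mc2_weight_even: "mc2_weight (Suc h) (2 * k) = mc2_weight h k"
  by simp

lemma mc2_weight_odd: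
  "mc2_weight (Suc h) (2 * k + 1) = Suc (min (mc2_weight h k) (mc2_weight h (k + 1)))"
  by simp

declare mc2_weight.simps(2) [simp del]

lemma mc2_weight_zero [simp]: "mc2_weight h 0 = 0"
  by (induction h) (simp_all add: mc2_weight.simps(2))

lemma int_parity_cases:
  fixes j :: int
  obtains (even) k where "j = 2 * k" | (odd) k where "j = 2 * k + 1"
  by (metis evenE oddE)

lemma mc2_weight_add_multiple: "mc2_weight h (j + 2 ^ h * t) = mc2_weight h j"
proof (induction h arbitrary: j)
  case (Suc h)
  show ?case
  proof (cases j rule: int_parity_cases)
    case (even k)
    have "j + 2 ^ Suc h * t = 2 * (k + 2 ^ h * t)"
      using even by simp
    then show ?thesis
      using Suc.IH[of k] even by (simp only: mc2_weight_even)
  next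
    case (odd k)
    have "j + 2 ^ Suc h * t = 2 * (k + 2 ^ h * t) + 1"
      using odd by simp
    moreover have "k + 2 ^ h * t + 1 = (k + 1) + 2 ^ h * t"
      by simp
    ultimately show ?thesis
      using Suc.IH[of k] Suc.IH[of "k + 1"] odd by (simp only: mc2_weight_odd)
  qed
qed simp

lemma mc2_weight_cong: "[i = j] (mod 2 ^ h) \<Longrightarrow> mc2_weight h i = mc2_weight h j"
  by (metis cong_iff_lin mc2_weight_add_multiple)

lemma mc2_weight_mod: "mc2_weight h (j mod 2 ^ h) = mc2_weight h j"
  by (rule mc2_weight_cong) simp

lemma mc2_weight_add_one:
  "mc2_weight h (j + 1) \<le> Suc (mc2_weight h j) \<and> mc2_weight h j \<le> Suc (mc2_weight h (j + 1))"
proof (induction h arbitrary: j)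
  case (Suc h)
  show ?case
  proof (cases j rule: int_parity_cases)
    case (even k)
    then show ?thesis
      using Suc.IH[of k] by (simp only: mc2_weight_even mc2_weight_odd) linarith
  next
    case (odd k)
    then have "j + 1 = 2 * (k + 1)"
      by simp
    then show ?thesis
      using Suc.IH[of k] odd by (simp only: mc2_weight_even mc2_weight_odd) linarith
  qed
qed simp

text \<open>Halving turns a step \<open>2 ^ i\<close> into \<open>2 ^ (i - 1)\<close> whatever the
  parity of \<open>j\<close>, down to a step of one. Applied to each arc, the bound makes the weight
  a lower bound for walk lengths.\<close>

lemma mc2_weight_add_power:
  assumes "i < h"
  shows "mc2_weight h (j + 2 ^ i) \<le> Suc (mc2_weight h j) \<and>
    mc2_weight h j \<le> Suc (mc2_weight h (j + 2 ^ i))"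
  using assms
proof (induction h arbitrary: i j)
  case (Suc h)
  show ?case
  proof (cases i)
    case 0
    then show ?thesis
      using mc2_weight_add_one by simp
  next
    case (Suc i')
    then have "i' < h"
      using Suc.prems by simp
    note IH = Suc.IH[OF this]
    show ?thesis
    proof (cases j rule: int_parity_cases)
      case (even k)
      then have "j + 2 ^ i = 2 * (k + 2 ^ i')"
        using Suc by simp
      then show ?thesis
        using IH[of k] even by (simp only: mc2_weight_even)
    next
      case (odd k)
      then have "j + 2 ^ i = 2 * (k + 2 ^ i') + 1"
        using Suc by simp
      moreover have "k + 2 ^ i' + 1 = (k + 1) + 2 ^ i'"
        by simp
      ultimately show ?thesis
        using IH[of k] IH[of "k + 1"] odd by (simp only: mc2_weight_odd) linarith
    qed
  qed
qed simp

lemma mc2_weight_eq_0_dvd: "mc2_weight h j = 0 \<Longrightarrow> 2 ^ h dvd j"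
proof (induction h arbitrary: j)
  case (Suc h)
  then show ?case
    by (cases j rule: int_parity_cases) (simp_all add: mc2_weight_even mc2_weight_odd)
qed simp

text \<open>Descent, for building a walk whose length is the weight. For even \<open>j\<close>, a
  step that works for \<open>j div 2\<close> is doubled; for odd \<open>j\<close>, a step of one
  leads to the even neighbour attaining the minimum.\<close>

lemma mc2_weight_decrease:
  assumes "mc2_weight h j = Suc w"
  shows "\<exists>i<h. mc2_weight h (j + 2 ^ i) = w \<or> mc2_weight h (j - 2 ^ i) = w"
  using assms
proof (induction h arbitrary: j)
  case (Suc h)
  show ?case
  proof (cases j rule: int_parity_cases)
    case (even k)
    then obtain i where i: "i < h" "mc2_weight h (k + 2 ^ i) = w \<or> mc2_weight h (k - 2 ^ i) = w"
      using Suc mc2_weight_even by metis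
    have "j + 2 ^ Suc i = 2 * (k + 2 ^ i)" "j - 2 ^ Suc i = 2 * (k - 2 ^ i)"
      using even by simp_all
    then have "mc2_weight (Suc h) (j + 2 ^ Suc i) = w \<or> mc2_weight (Suc h) (j - 2 ^ Suc i) = w"
      using i(2) by (simp only: mc2_weight_even)
    then show ?thesis
      using i(1) by blast
  next
    case (odd k)
    then have "w = mc2_weight h k \<or> w = mc2_weight h (k + 1)"
      using Suc.prems by (auto simp: mc2_weight_odd min_def split: if_splits)
    moreover have "j + 2 ^ 0 = 2 * (k + 1)" "j - 2 ^ 0 = 2 * k"
      using odd by simp_all
    ultimately have "mc2_weight (Suc h) (j + 2 ^ 0) = w \<or> mc2_weight (Suc h) (j - 2 ^ 0) = w"
      by (simp only: mc2_weight_even) blast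
    then show ?thesis
      by blast
  qed
qed simp

section \<open>Walks and the graph distance\<close>

lemma (in wf_digraph) awalk_imp_shorter_apath:
  assumes "awalk u p v"
  shows "\<exists>q. apath u q v \<and> length q \<le> length p"
  using assms
proof (induction p rule: awalk_to_apath_induct)
  case (path p)
  then show ?case
    by (auto simp: apath_def)
next
  case (decomp p q r s)
  then have "p = q @ r @ s"
    using awalk_cyc_decomp_has_prop[of u p v] by auto
  then show ?case
    using decomp by fastforce
qed

text \<open>Cutting out cycles never lengthens a walk, so the infimum over paths can be computed
  from walks, which are easier to build and extend.\<close>

lemma graph_dist_eqI:
  assumes "wf_digraph G"
    and walk: "pre_digraph.awalk G u p v" "length p = d"
    and lower: "\<And>q. pre_digraph.awalk G u q v \<Longrightarrow> d \<le> length q"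
  shows "graph_dist G u v = enat d"
proof -
  interpret wf_digraph G
    by fact
  obtain q where q: "apath u q v" "length q \<le> d"
    using awalk_imp_shorter_apath walk by blast
  show ?thesis
    unfolding graph_dist_def
  proof (rule antisym)
    show "(INF p \<in> {p. apath u p v}. enat (length p)) \<le> enat d"
      using q by (intro INF_lower2[of q]) auto
    show "enat d \<le> (INF p \<in> {p. apath u p v}. enat (length p))"
      using lower by (intro INF_greatest) (auto dest: awalkI_apath)
  qed
qed

lemma wf_digraph_mult_circulant: "wf_digraph (with_proj (mult_circulant m h))"
proof -
  interpret pair_graph "mult_circulant m h"
    by (rule pair_graph_mult_circulant)
  show ?thesis
    by unfold_locales
qed

lemma mc2_weight_arc_le:
  assumes "(x, y) \<in> parcs (Gamma2 h)"
  shows "mc2_weight h y \<le> Suc (mc2_weight h x)"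
proof -
  obtain i where i: "i < h" "[x - y = 2 ^ i] (mod 2 ^ h) \<or> [x - y = - (2 ^ i)] (mod 2 ^ h)"
    using assms by (auto simp: mult_circulant_def)
  from i(2) show ?thesis
  proof
    assume "[x - y = 2 ^ i] (mod 2 ^ h)"
    then have "[x = y + 2 ^ i] (mod 2 ^ h)"
      by (simp add: cong_iff_dvd_diff algebra_simps)
    then show ?thesis
      using mc2_weight_add_power[OF i(1), of y] by (simp add: mc2_weight_cong)
  next
    assume "[x - y = - (2 ^ i)] (mod 2 ^ h)"
    then have "[y = x + 2 ^ i] (mod 2 ^ h)"
      by (subst cong_sym_eq) (simp add: cong_iff_dvd_diff algebra_simps)
    then show ?thesis
      using mc2_weight_add_power[OF i(1), of x] by (simp add: mc2_weight_cong)
  qed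
qed

lemma mc2_weight_awalk_le:
  assumes "pre_digraph.awalk (with_proj (Gamma2 h)) u p v"
  shows "mc2_weight h v \<le> mc2_weight h u + length p"
proof -
  interpret wf_digraph "with_proj (Gamma2 h)"
    by (rule wf_digraph_mult_circulant)
  show ?thesis
    using assms
  proof (induction p arbitrary: u)
    case (Cons e p)
    then show ?case
      using mc2_weight_arc_le[of "fst e" "snd e" h] by (fastforce simp: awalk_simps)
  qed (simp add: awalk_simps)
qed

lemma mc2_weight_awalk_exists:
  "\<exists>p. pre_digraph.awalk (with_proj (Gamma2 h)) 0 p (j mod 2 ^ h) \<and> length p = mc2_weight h j"
proof -
  interpret wf_digraph "with_proj (Gamma2 h)"
    by (rule wf_digraph_mult_circulant)
  show ?thesis
  proof (induction "mc2_weight h j" arbitrary: j)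
    case 0
    then have "j mod 2 ^ h = 0"
      using mc2_weight_eq_0_dvd[of h j] by simp
    moreover have "0 \<in> pverts (Gamma2 h)"
      by (simp add: mult_circulant_def)
    ultimately have "awalk 0 [] (j mod 2 ^ h)"
      by (simp add: awalk_simps)
    then show ?case
      using 0 by (metis list.size(3))
  next
    case (Suc w)
    obtain i j' where i: "i < h" and j': "j' = j + 2 ^ i \<or> j' = j - 2 ^ i" "mc2_weight h j' = w"
      using mc2_weight_decrease[of h j w] Suc(2) by metis
    obtain p where p: "awalk 0 p (j' mod 2 ^ h)" "length p = w"
      using Suc(1)[of j'] j'(2) by blast
    \<comment> \<open>Arcs join distinct vertices only; here the weights \<open>w\<close> and
      \<open>Suc w\<close> tell the residues apart.\<close>
    have "j' mod 2 ^ h \<noteq> j mod 2 ^ h"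
      using Suc(2) j'(2) mc2_weight_mod[of h j] mc2_weight_mod[of h j'] by auto
    moreover have "[j' mod 2 ^ h - j mod 2 ^ h = j' - j] (mod 2 ^ h)"
      by (simp add: cong_def mod_simps)
    ultimately have "(j' mod 2 ^ h, j mod 2 ^ h) \<in> parcs (Gamma2 h)"
      using i j'(1) by (auto simp: mult_circulant_def)
    then have "awalk (j' mod 2 ^ h) [(j' mod 2 ^ h, j mod 2 ^ h)] (j mod 2 ^ h)"
      using arc_implies_awalk[of "(j' mod 2 ^ h, j mod 2 ^ h)"] by simp
    then have "awalk 0 (p @ [(j' mod 2 ^ h, j mod 2 ^ h)]) (j mod 2 ^ h)"
      using p(1) by (rule awalk_appendI[rotated])
    then show ?case
      using p(2) Suc(2) by (metis length_append_singleton)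
  qed
qed

lemma Gamma2_dist_eq_mc2_weight: "Gamma2_dist h 0 j = enat (mc2_weight h j)"
proof -
  obtain p where p: "pre_digraph.awalk (with_proj (Gamma2 h)) 0 p (j mod 2 ^ h)"
    "length p = mc2_weight h j"
    using mc2_weight_awalk_exists by blast
  have "mc2_weight h j \<le> length q"
    if "pre_digraph.awalk (with_proj (Gamma2 h)) 0 q (j mod 2 ^ h)" for q
    using mc2_weight_awalk_le[OF that] by (simp add: mc2_weight_mod)
  then show ?thesis
    unfolding Gamma2_dist_def using graph_dist_eqI[OF wf_digraph_mult_circulant p] by simp
qed

section \<open>Comparison of consecutive weights at the threshold\<close>

text \<open>The threshold is indexed so that \<open>mc2_threshold h\<close> separates the two cases in the comparison
  of \<open>2^h\<close> with \<open>2^(h + 1)\<close> vertices; its binary expansion is \<open>\<dots>10101\<close> or \<open>\<dots>1010\<close>.\<close>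

fun mc2_threshold :: "nat \<Rightarrow> int" where
  "mc2_threshold 0 = 0"
| "mc2_threshold (Suc h) = 2 * mc2_threshold h + (if even h then 1 else 0)"

text \<open>One of the two arguments at \<open>Suc h\<close> is
  \<open>2 * mc2_threshold h + 1\<close>; the minimum in its weight is attained at
  \<open>mc2_threshold h + 1\<close>, by the induction hypothesis in either parity.\<close>

lemma mc2_weight_at_threshold:
  "mc2_weight h (mc2_threshold h) = mc2_weight h (mc2_threshold h + 1) + (if even h then 0 else 1)"
proof (induction h)
  case (Suc h)
  show ?case
  proof (cases "even h")
    case True
    have "mc2_threshold (Suc h) + 1 = 2 * (mc2_threshold h + 1)"
      using True by simp
    then have "mc2_weight (Suc h) (mc2_threshold (Suc h) + 1) = mc2_weight h (mc2_threshold h + 1)"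
      by (simp only: mc2_weight_even)
    then show ?thesis
      using Suc True by (simp add: mc2_weight_odd)
  next
    case False
    then show ?thesis
      using Suc by (simp add: mc2_weight_even mc2_weight_odd)
  qed
qed simp

lemma mc2_weight_Suc:
  assumes "0 \<le> j" "j \<le> 2 ^ h"
  shows "mc2_weight (Suc h) j = mc2_weight h j + (if j \<le> mc2_threshold h then 0 else 1)"
  using assms
proof (induction h arbitrary: j)
  case 0
  then have "j = 0 \<or> j = 1"
    by auto
  then show ?case
    by (auto simp: mc2_weight.simps(2))
next
  case (Suc h)
  let ?T = "mc2_threshold h"
  show ?case
  proof (cases j rule: int_parity_cases)
    case (even k)
    then have "0 \<le> k" "k \<le> 2 ^ h"
      using Suc.prems by auto
    moreover have "j \<le> mc2_threshold (Suc h) \<longleftrightarrow> k \<le> ?T"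
      using even by auto
    ultimately show ?thesis
      using Suc.IH[of k] even by (simp only: mc2_weight_even)
  next
    case (odd k)
    then have k: "0 \<le> k" "k + 1 \<le> 2 ^ h"
      using Suc.prems by auto
    have j: "mc2_weight (Suc (Suc h)) j = Suc (min (mc2_weight (Suc h) k) (mc2_weight (Suc h) (k + 1)))"
      "mc2_weight (Suc h) j = Suc (min (mc2_weight h k) (mc2_weight h (k + 1)))"
      using odd by (simp_all only: mc2_weight_odd)
    note IH = Suc.IH[of k] Suc.IH[of "k + 1"]
    consider "k < ?T" | "k = ?T" | "k > ?T"
      by linarith
    then show ?thesis
    proof cases
      case 1
      then show ?thesis
        using IH k odd unfolding j by auto
    next
      \<comment> \<open>Here \<open>j = 2 * ?T + 1\<close>, and passing to \<open>Suc h\<close>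
        raises only the weight at \<open>k + 1\<close>. The minimum is unchanged for even
        \<open>h\<close>, where both weights agree, and grows by one for odd \<open>h\<close>, where
        \<open>k + 1\<close> has the smaller weight.\<close>
      case 2
      then show ?thesis
        using IH k odd mc2_weight_at_threshold[of h] unfolding j by auto
    next
      case 3
      then show ?thesis
        using IH k odd unfolding j by auto
    qed
  qed
qed

lemma mc2_threshold_closed_form:
  "mc2_threshold (2 * n) = 2 * ((4 ^ n - 1) div 3) \<and>
   mc2_threshold (2 * n + 1) = (4 ^ Suc n - 1) div 3"
proof -
  \<comment> \<open>Tripling keeps the induction free of \<open>div\<close>; one unfolding of the
    recursion gives the odd index.\<close>
  have "3 * mc2_threshold (2 * n) = 2 * (4 ^ n - 1)"
    by (induction n) simp_all
  then show ?thesis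
    by simp presburger
qed

theorem theorem3p6:
  fixes h n :: nat
  assumes "h \<ge> 1"
  shows "(h = 2 * n \<longrightarrow>
      (\<forall>j \<in> {0..(4 ^ n - 1) div 3}. Gamma2_dist h 0 j = Gamma2_dist (h - 1) 0 j) \<and>
      (\<forall>j \<in> {(4 ^ n - 1) div 3 + 1..2 ^ (h - 1)}. Gamma2_dist h 0 j = Gamma2_dist (h - 1) 0 j + 1)) \<and>
    (h = 2 * n + 1 \<longrightarrow>
      (\<forall>j \<in> {0..2 * ((4 ^ n - 1) div 3)}. Gamma2_dist h 0 j = Gamma2_dist (h - 1) 0 j) \<and>
      (\<forall>j \<in> {2 * ((4 ^ n - 1) div 3) + 1..2 ^ (h - 1)}. Gamma2_dist h 0 j = Gamma2_dist (h - 1) 0 j + 1))"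
proof -
  obtain k where k: "h = Suc k"
    using assms by (cases h) auto
  \<comment> \<open>These bounds put both ranges of \<open>j\<close> inside \<open>0..2 ^ k\<close>,
    as \<open>mc2_weight_Suc\<close> requires.\<close>
  have bounds: "0 \<le> mc2_threshold m \<and> mc2_threshold m < 2 ^ m" for m
    by (induction m) auto
  have low: "Gamma2_dist h 0 j = Gamma2_dist (h - 1) 0 j" if "j \<in> {0..mc2_threshold k}" for j
    using that mc2_weight_Suc[of j k] bounds[of k] k
    by (auto simp: Gamma2_dist_eq_mc2_weight split: if_splits)
  have high: "Gamma2_dist h 0 j = Gamma2_dist (h - 1) 0 j + 1"
    if "j \<in> {mc2_threshold k + 1..2 ^ (h - 1)}" for j
    using that mc2_weight_Suc[of j k] bounds[of k] k
    by (auto simp: Gamma2_dist_eq_mc2_weight one_enat_def)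
  \<comment> \<open>Here \<open>k = 2 * (n - 1) + 1\<close>, so the closed form for odd index
    applies; \<open>n = 0\<close> contradicts \<open>h = Suc k\<close>.\<close>
  have "mc2_threshold k = (4 ^ n - 1) div 3" if "h = 2 * n"
    using that k mc2_threshold_closed_form[of "n - 1"] by (cases n) auto
  moreover have "mc2_threshold k = 2 * ((4 ^ n - 1) div 3)" if "h = 2 * n + 1"
    using that k mc2_threshold_closed_form[of n] by auto
  ultimately show ?thesis
    using low high by metis
qed

end
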